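(* Let $X\in\mathbb{R}^{m\times N}$ with $X^\top X$ invertible, let $w\in\mathbb{R}^N$, and let $\mathcal{A}\subset\mathbb{R}$ be a finite nonempty set with associated round-to-nearest operator $\mathcal{Q}$. The OPTQ iterations (defined in the context) applied to $w$ with layer input $X$ are equivalent to the iterations \begin{align*} q_t &= \underset{p \in \mathcal{A}}{\arg\min}\ \tfrac{1}{2} \Big\| Xw - \sum_{j=1}^{t-1} q_j X_j - p X_t - \sum_{j = t+1}^{N} w^{(t-1)}_j X_j \Big\|^2,\\ w^{(t)}_{\geq t+1} &= \underset{(v_{t+1}, \dots, v_N) \in \mathbb{R}^{N - t}}{\arg\min}\ \tfrac{1}{2} \Big\| Xw - \sum_{j=1}^{t} q_j X_j - \sum_{j = t+1}^{N} v_j X_j \Big\|^2, \end{align*} for $t=1,\dots,N$, with $w^{(0)}_{\geq 1}=w$. That is, for every $t=1,\dots,N$, the quantized weight $q_t$ and the updated weights $w^{(t-1)}_{\ge t}$ produced by the two procedures are identical.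
   Context: Indices start at 1. $\|\cdot\|$ is the Euclidean norm, $X_j$ is the $j$-th column of $X$, and $v_{\ge t}=(v_t,\dots,v_N)^\top$. For $t=N$ the weight updates are vacuous. $\mathcal{A}\subset\mathbb{R}$ is the (finite, nonempty) quantization grid and $\mathcal{Q}:\mathbb{R}\to\mathcal{A}$ is the round-to-nearest operator: $\mathcal{Q}(x)$ is an element of $\mathcal{A}$ closest to $x$. Ties between two elements of $\mathcal{A}$ are resolved by a fixed rule that selects one element from any pair of elements of $\mathcal{A}$; the same rule is used in $\mathcal{Q}$ and in every $\arg\min_{p\in\mathcal{A}}$. OPTQ iterations: let $H=X^\top X$ and let $H^{-1}=LL^\top$ be the Cholesky decomposition, with $L$ lower triangular with positive diagonal. Starting from $w^{(0)}=w$, for $t=1,\dots,N$ set $$q_t=\mathcal{Q}\big(w^{(t-1)}_t\big),\qquad w^{(t)}_{\ge t+1}=w^{(t-1)}_{\ge t+1}-\frac{w^{(t-1)}_t-q_t}{L_{tt}}\,L_{\ge t+1,\,t},$$ where $L_{\ge t+1,t}=(L_{t+1,t},\dots,L_{N,t})^\top\in\mathbb{R}^{N-t}$. *)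

theory Defs
  imports Complex_Main "Jordan_Normal_Form.Matrix"
begin

text \<open>
  Indices start at 0: the informal step \<open>t = 1, \<dots>, N\<close> is step \<open>t - 1 < N\<close> here. The weights after
  \<open>t\<close> steps are represented by the vector \<open>W t\<close> of dimension \<open>N - t\<close> of the weights that have
  not been quantized yet, so the weight with (0-based) index \<open>j \<ge> t\<close> is \<open>W t $ (j - t)\<close>.
\<close>

definition euclidean_norm :: "real vec \<Rightarrow> real" where
  "euclidean_norm v = sqrt (v \<bullet> v)"

text \<open>
  A tie-breaking rule picks one element from every unordered pair of grid elements; the pair
  may be degenerate (\<open>a = b\<close>), in which case that element is picked.
\<close>

definition tie_rule :: "real set \<Rightarrow> (real set \<Rightarrow> real) \<Rightarrow> bool" where
  "tie_rule A sel \<longleftrightarrow> (\<forall>a\<in>A. \<forall>b\<in>A. sel {a, b} \<in> {a, b})"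

text \<open>
  The rule is applied to the set of all minimizers. For the objectives used below this set has
  at most two elements, so the values of \<open>sel\<close> on larger sets play no role.
\<close>

definition grid_argmin :: "(real set \<Rightarrow> real) \<Rightarrow> real set \<Rightarrow> (real \<Rightarrow> real) \<Rightarrow> real" where
  "grid_argmin sel A f = sel {p. is_arg_min f (\<lambda>p. p \<in> A) p}"

definition round_nearest :: "(real set \<Rightarrow> real) \<Rightarrow> real set \<Rightarrow> real \<Rightarrow> real" where
  "round_nearest sel A x = grid_argmin sel A (\<lambda>p. \<bar>x - p\<bar>)"

definition cholesky_factor :: "real mat \<Rightarrow> real mat \<Rightarrow> bool" where
  "cholesky_factor M L \<longleftrightarrow>
     L \<in> carrier_mat (dim_row M) (dim_row M) \<and>
     upper_triangular (transpose_mat L) \<and>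
     (\<forall>i<dim_row M. L $$ (i, i) > 0) \<and>
     M = L * transpose_mat L"

primrec optq_weights ::
  "(real set \<Rightarrow> real) \<Rightarrow> real set \<Rightarrow> real mat \<Rightarrow> real vec \<Rightarrow> nat \<Rightarrow> real vec" where
  "optq_weights sel A L w 0 = w"
| "optq_weights sel A L w (Suc t) =
     (let W = optq_weights sel A L w t;
          q = round_nearest sel A (W $ 0)
      in vec (dim_vec w - Suc t)
           (\<lambda>i. W $ Suc i - (W $ 0 - q) / L $$ (t, t) * L $$ (Suc t + i, t)))"

definition optq_quantized ::
  "(real set \<Rightarrow> real) \<Rightarrow> real set \<Rightarrow> real mat \<Rightarrow> real vec \<Rightarrow> nat \<Rightarrow> real" where
  "optq_quantized sel A L w t = round_nearest sel A (optq_weights sel A L w t $ 0)"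

definition col_sum :: "real mat \<Rightarrow> (nat \<Rightarrow> real) \<Rightarrow> nat set \<Rightarrow> real vec" where
  "col_sum X c J = finsum_vec TYPE(real) (dim_row X) (\<lambda>j. c j \<cdot>\<^sub>v col X j) J"

definition quantization_objective ::
  "real mat \<Rightarrow> real vec \<Rightarrow> (nat \<Rightarrow> real) \<Rightarrow> real vec \<Rightarrow> nat \<Rightarrow> real \<Rightarrow> real" where
  "quantization_objective X w q W t p =
     1 / 2 * (euclidean_norm
       (X *\<^sub>v w - col_sum X q {..<t} - p \<cdot>\<^sub>v col X t
         - col_sum X (\<lambda>j. W $ (j - t)) {t<..<dim_col X}))\<^sup>2"

definition update_objective ::
  "real mat \<Rightarrow> real vec \<Rightarrow> (nat \<Rightarrow> real) \<Rightarrow> nat \<Rightarrow> real vec \<Rightarrow> real" where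
  "update_objective X w q t v =
     1 / 2 * (euclidean_norm
       (X *\<^sub>v w - col_sum X q {..t}
         - col_sum X (\<lambda>j. v $ (j - Suc t)) {t<..<dim_col X}))\<^sup>2"

text \<open>
  The iteration is a relation between runs \<open>(q, W)\<close> and the input, because the continuous
  minimization is not assumed to have a unique solution.
\<close>

definition argmin_iterates ::
  "(real set \<Rightarrow> real) \<Rightarrow> real set \<Rightarrow> real mat \<Rightarrow> real vec \<Rightarrow>
     (nat \<Rightarrow> real) \<Rightarrow> (nat \<Rightarrow> real vec) \<Rightarrow> bool" where
  "argmin_iterates sel A X w q W \<longleftrightarrow>
     W 0 = w \<and>
     (\<forall>t<dim_col X.
        q t = grid_argmin sel A (quantization_objective X w q (W t) t) \<and>
        is_arg_min (update_objective X w q t)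
          (\<lambda>v. v \<in> carrier_vec (dim_col X - Suc t)) (W (Suc t)))"

end

theory Submission
  imports Defs
begin

text \<open>
  Write \<open>d t\<close> for \<open>w\<close> minus the vector consisting of the first \<open>t\<close> quantized weights followed by
  the current unquantized ones, so that both objectives are half the squared norm of \<open>X\<close> applied
  to such a difference. An OPTQ step adds a multiple of the column \<open>L\<^sub>t\<close> to \<open>d t\<close>, and
  \<open>H L = L\<^sup>-\<^sup>\<top>\<close> is upper triangular, so by induction \<open>H (d t)\<close> vanishes at all positions
  \<open>\<ge> t\<close>. Hence \<open>X (d t)\<close> is orthogonal to all columns \<open>X\<^sub>j\<close> with \<open>j \<ge> t\<close>, and Pythagoras gives both
  claims: the OPTQ update is the unique least squares solution, and the quantization objective is,
  up to a constant, \<open>(W\<^sub>t - p)\<^sup>2 \<parallel>X\<^sub>t\<parallel>\<^sup>2 / 2\<close>, whose minimizers on the grid are the nearest points.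
\<close>

section \<open>The two objectives as squared norms of \<open>X\<close> applied to an error
  vector\<close>

lemma euclidean_norm_squared: "(euclidean_norm v)\<^sup>2 = v \<bullet> v"
  unfolding euclidean_norm_def by (simp add: scalar_prod_def sum_nonneg)

text \<open>Padding the coefficients with zeros makes a partial column sum an image under
  \<open>X\<close>, so that linearity of \<open>X\<close> can merge it with the other terms.\<close>

lemma col_sum_eq_mult_mat_vec:
  assumes "J \<subseteq> {..<dim_col X}"
  shows "col_sum X c J = X *\<^sub>v vec (dim_col X) (\<lambda>j. if j \<in> J then c j else 0)"
proof (rule eq_vecI)
  have fin: "finite J" using assms finite_subset by blast
  have carr: "(\<lambda>j. c j \<cdot>\<^sub>v col X j) \<in> J \<rightarrow> carrier_vec (dim_row X)" by auto
  show "dim_vec (col_sum X c J) = dim_vec (X *\<^sub>v vec (dim_col X) (\<lambda>j. if j \<in> J then c j else 0))"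
    using finsum_vec_closed[OF carr] by (auto simp: col_sum_def)
  fix i
  assume "i < dim_vec (X *\<^sub>v vec (dim_col X) (\<lambda>j. if j \<in> J then c j else 0))"
  then have i: "i < dim_row X" by simp
  have "col_sum X c J $ i = (\<Sum>j\<in>J. c j * X $$ (i, j))"
    unfolding col_sum_def using index_finsum_vec[OF fin i carr] i assms
    by (auto intro!: sum.cong)
  also have "\<dots> = (\<Sum>j\<in>{..<dim_col X} \<inter> J. X $$ (i, j) * c j)"
    using assms by (intro sum.cong) auto
  also have "\<dots> = (\<Sum>j\<in>{..<dim_col X}. X $$ (i, j) * (if j \<in> J then c j else 0))"
    by (simp add: sum.inter_restrict if_distrib cong: if_cong)
  also have "\<dots> = (X *\<^sub>v vec (dim_col X) (\<lambda>j. if j \<in> J then c j else 0)) $ i"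
    using i by (simp add: scalar_prod_def atLeast0LessThan)
  finally show "col_sum X c J $ i = (X *\<^sub>v vec (dim_col X) (\<lambda>j. if j \<in> J then c j else 0)) $ i" .
qed

text \<open>This is the \<open>d t\<close> of the overview. It always has full length, so that
  errors at different steps can be compared; \<open>j - t\<close> undoes the shift in the storage of
  the unquantized weights. The values \<open>q\<close> are a parameter because the argmin procedure
  brings its own.\<close>

definition weight_error ::
  "real vec \<Rightarrow> (nat \<Rightarrow> real) \<Rightarrow> nat \<Rightarrow> real vec \<Rightarrow> real vec" where
  "weight_error w q t v = vec (dim_vec w) (\<lambda>j. w $ j - (if j < t then q j else v $ (j - t)))"

lemma weight_error_carrier: "w \<in> carrier_vec N \<Longrightarrow> weight_error w q t v \<in> carrier_vec N"
  unfolding weight_error_def by (rule carrier_vecI) simp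

lemma weight_error_cong:
  "(\<And>s. s < t \<Longrightarrow> q s = q' s) \<Longrightarrow> weight_error w q t v = weight_error w q' t v"
  unfolding weight_error_def by (rule eq_vecI) simp_all

lemma update_objective_eq:
  assumes X: "X \<in> carrier_mat m N" and w: "w \<in> carrier_vec N" and t: "t < N"
  shows "update_objective X w q t v =
    1 / 2 * ((X *\<^sub>v weight_error w q (Suc t) v) \<bullet> (X *\<^sub>v weight_error w q (Suc t) v))"
proof -
  let ?a = "vec N (\<lambda>j. if j \<in> {..t} then q j else 0)"
  let ?b = "vec N (\<lambda>j. if j \<in> {t<..<N} then v $ (j - Suc t) else 0)"
  have "weight_error w q (Suc t) v = w - ?a - ?b"
    using w by (auto simp: weight_error_def less_Suc_eq_le)
  then have "X *\<^sub>v weight_error w q (Suc t) v = X *\<^sub>v w - X *\<^sub>v ?a - X *\<^sub>v ?b"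
    using X w by (simp add: mult_minus_distrib_mat_vec[where nr = m and nc = N])
  moreover have "col_sum X q {..t} = X *\<^sub>v ?a"
    "col_sum X (\<lambda>j. v $ (j - Suc t)) {t<..<N} = X *\<^sub>v ?b"
    using X t by (subst col_sum_eq_mult_mat_vec; auto)+
  ultimately show ?thesis
    using X by (simp add: update_objective_def euclidean_norm_squared)
qed

text \<open>The error counts \<open>W $ 0\<close> as the weight at position \<open>t\<close>;
  putting \<open>p\<close> there instead adds \<open>W $ 0 - p\<close> at that position.\<close>

lemma quantization_objective_eq:
  assumes X: "X \<in> carrier_mat m N" and w: "w \<in> carrier_vec N" and t: "t < N"
  shows "quantization_objective X w q W t p =
    1 / 2 * ((X *\<^sub>v (weight_error w q t W + (W $ 0 - p) \<cdot>\<^sub>v unit_vec N t)) \<bullet>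
             (X *\<^sub>v (weight_error w q t W + (W $ 0 - p) \<cdot>\<^sub>v unit_vec N t)))"
proof -
  let ?a = "vec N (\<lambda>j. if j \<in> {..<t} then q j else 0)"
  let ?b = "vec N (\<lambda>j. if j \<in> {t<..<N} then W $ (j - t) else 0)"
  have "weight_error w q t W + (W $ 0 - p) \<cdot>\<^sub>v unit_vec N t
      = w - ?a - p \<cdot>\<^sub>v unit_vec N t - ?b"
    using w t by (auto simp: weight_error_def unit_vec_def)
  moreover have "X *\<^sub>v (p \<cdot>\<^sub>v unit_vec N t) = p \<cdot>\<^sub>v col X t"
    using X t by (intro eq_vecI) (auto simp: mult_mat_vec[where nr = m and nc = N])
  ultimately have "X *\<^sub>v (weight_error w q t W + (W $ 0 - p) \<cdot>\<^sub>v unit_vec N t)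
      = X *\<^sub>v w - X *\<^sub>v ?a - p \<cdot>\<^sub>v col X t - X *\<^sub>v ?b"
    using X w by (simp add: mult_minus_distrib_mat_vec[where nr = m and nc = N])
  moreover have "col_sum X q {..<t} = X *\<^sub>v ?a"
    "col_sum X (\<lambda>j. W $ (j - t)) {t<..<N} = X *\<^sub>v ?b"
    using X t by (subst col_sum_eq_mult_mat_vec; auto)+
  ultimately show ?thesis
    using X by (simp add: quantization_objective_def euclidean_norm_squared)
qed

section \<open>The Gram matrix and its Cholesky factor\<close>

lemma gram_scalar_prod:
  fixes X :: "real mat"
  assumes X: "X \<in> carrier_mat m N" and a: "a \<in> carrier_vec N" and b: "b \<in> carrier_vec N"
  shows "(X *\<^sub>v a) \<bullet> (X *\<^sub>v b) = a \<bullet> ((transpose_mat X * X) *\<^sub>v b)"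
proof -
  have "(X *\<^sub>v a) \<bullet> (X *\<^sub>v b) = (transpose_mat X *\<^sub>v (X *\<^sub>v b)) \<bullet> a"
    using X a b by (subst transpose_vec_mult_scalar[OF X a])
      (auto intro!: comm_scalar_prod[of _ m])
  also have "\<dots> = a \<bullet> (transpose_mat X *\<^sub>v (X *\<^sub>v b))"
    using X a b by (auto intro!: comm_scalar_prod[of _ N])
  finally show ?thesis using X b by (simp add: assoc_mult_mat_vec[where n\<^sub>1 = N])
qed

text \<open>\<open>K = H * L\<close> is the inverse of the upper triangular matrix
  \<open>transpose_mat L\<close>, hence upper triangular itself. Its entries in row \<open>j\<close>
  left of the diagonal are found to be zero by forward substitution, from left to right.\<close>

lemma inverse_of_cholesky_upper:
  fixes H L :: "real mat"
  assumes H: "H \<in> carrier_mat N N" and L: "L \<in> carrier_mat N N"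
    and inv: "H * (L * transpose_mat L) = 1\<^sub>m N"
    and lower: "upper_triangular (transpose_mat L)"
    and diag: "\<forall>i<N. L $$ (i, i) > 0"
    and j: "j < N" and i: "i < j"
  shows "(H * L) $$ (j, i) = 0"
  using i
proof (induction i rule: less_induct)
  case (less i)
  define K where "K = H * L"
  have K: "K \<in> carrier_mat N N" using H L by (simp add: K_def)
  have iN: "i < N" using less.prems j by simp
  have "K * transpose_mat L = 1\<^sub>m N" unfolding K_def using H L inv by (simp add: assoc_mult_mat[of _ N N _ N _ N])
  then have "(K * transpose_mat L) $$ (j, i) = 0" using j iN less.prems by simp
  then have "(\<Sum>k\<in>{0..<N}. K $$ (j, k) * L $$ (i, k)) = 0"
    using K L j iN by (simp add: scalar_prod_def)
  \<comment> \<open>Terms with \<open>k < i\<close> vanish by induction, those with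
    \<open>k > i\<close> because \<open>L\<close> is lower triangular. The remaining factor
    \<open>L $$ (i, i)\<close> is positive.\<close>
  moreover have "(\<Sum>k\<in>{0..<N}. K $$ (j, k) * L $$ (i, k)) = (\<Sum>k\<in>{i}. K $$ (j, k) * L $$ (i, k))"
  proof (rule sum.mono_neutral_right)
    show "\<forall>k\<in>{0..<N} - {i}. K $$ (j, k) * L $$ (i, k) = 0"
    proof
      fix k assume k: "k \<in> {0..<N} - {i}"
      show "K $$ (j, k) * L $$ (i, k) = 0"
      proof (cases "k < i")
        case True
        then show ?thesis using less by (simp add: K_def)
      next
        case False
        then have "L $$ (i, k) = 0"
          using k L lower[unfolded upper_triangular_def, rule_format, of k i] iN by simp
        then show ?thesis by simp
      qed
    qed
  qed (use iN in auto)
  ultimately show ?case using diag iN by (auto simp: K_def)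
qed

section \<open>Normal equations along the OPTQ iteration\<close>

lemma optq_weights_carrier:
  assumes "w \<in> carrier_vec N"
  shows "optq_weights sel A L w t \<in> carrier_vec (N - t)"
  using assms by (cases t) (auto simp: Let_def intro!: carrier_vecI)

text \<open>Three ranges of positions: before \<open>t\<close> the column of \<open>L\<close> is
  zero; at \<open>t\<close> dividing by the diagonal entry exchanges \<open>W t $ 0\<close> for
  \<open>q t\<close>; after \<open>t\<close> this is the OPTQ update.\<close>

lemma weight_error_optq_Suc:
  fixes sel :: "real set \<Rightarrow> real" and A :: "real set"
  assumes w: "w \<in> carrier_vec N" and L: "L \<in> carrier_mat N N" and t: "t < N"
    and lower: "upper_triangular (transpose_mat L)"
    and diag: "\<forall>i<N. L $$ (i, i) > 0"
  defines "q \<equiv> optq_quantized sel A L w" and "W \<equiv> optq_weights sel A L w"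
  shows "weight_error w q (Suc t) (W (Suc t)) =
    weight_error w q t (W t) + ((W t $ 0 - q t) / L $$ (t, t)) \<cdot>\<^sub>v col L t"
proof (rule eq_vecI)
  fix j
  assume "j < dim_vec (weight_error w q t (W t) + ((W t $ 0 - q t) / L $$ (t, t)) \<cdot>\<^sub>v col L t)"
  then have j: "j < N" using L by simp
  consider "j < t" | "j = t" | "t < j" by linarith
  then show "weight_error w q (Suc t) (W (Suc t)) $ j =
    (weight_error w q t (W t) + ((W t $ 0 - q t) / L $$ (t, t)) \<cdot>\<^sub>v col L t) $ j"
  proof cases
    case 1
    then have "L $$ (j, t) = 0"
      using L lower[unfolded upper_triangular_def, rule_format, of t j] t by simp
    then show ?thesis using 1 w L t j by (simp add: weight_error_def)
  next
    case 2
    then show ?thesis using w L t diag[rule_format, OF t] by (simp add: weight_error_def)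
  next
    case 3
    have "W (Suc t) $ (j - Suc t) =
      W t $ Suc (j - Suc t) - (W t $ 0 - q t) / L $$ (t, t) * L $$ (Suc t + (j - Suc t), t)"
      using 3 w j by (simp add: W_def q_def optq_quantized_def Let_def del: add_Suc)
    moreover have "Suc t + (j - Suc t) = j" "Suc (j - Suc t) = j - t" using 3 by auto
    ultimately show ?thesis using 3 w L t j by (simp add: weight_error_def)
  qed
qed (use w L in \<open>simp_all add: weight_error_def\<close>)

text \<open>The initial error is zero. Step \<open>t\<close> adds a multiple of column
  \<open>t\<close> of \<open>H * L\<close>, which is zero below the diagonal, so the zeros at
  positions beyond \<open>t\<close> survive.\<close>

lemma optq_error_normal_equations:
  assumes H: "H \<in> carrier_mat N N" and w: "w \<in> carrier_vec N" and L: "L \<in> carrier_mat N N"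
    and inv: "H * (L * transpose_mat L) = 1\<^sub>m N"
    and lower: "upper_triangular (transpose_mat L)"
    and diag: "\<forall>i<N. L $$ (i, i) > 0"
    and t: "t \<le> N" and j: "t \<le> j" "j < N"
  shows "(H *\<^sub>v weight_error w (optq_quantized sel A L w) t (optq_weights sel A L w t)) $ j = 0"
  using t j
proof (induction t)
  case 0
  have "weight_error w (optq_quantized sel A L w) 0 w = 0\<^sub>v N"
    using w by (auto simp: weight_error_def)
  then show ?case using H 0 by simp
next
  case (Suc t)
  have "(H *\<^sub>v col L t) $ j = (H * L) $$ (j, t)" using H L Suc.prems by simp
  also have "\<dots> = 0" by (rule inverse_of_cholesky_upper[OF H L inv lower diag]) (use Suc.prems in auto)
  finally have "(H *\<^sub>v col L t) $ j = 0" .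
  moreover have "col L t \<in> carrier_vec N" using L by (metis carrier_matD(1) col_dim)
  ultimately show ?case
    using Suc H L weight_error_carrier[OF w]
    by (subst weight_error_optq_Suc[OF w L _ lower diag])
      (simp_all add: mult_add_distrib_mat_vec[where nr = N and nc = N]
        mult_mat_vec[where nr = N and nc = N] del: optq_weights.simps)
qed

section \<open>Orthogonality and positive definiteness\<close>

lemma gram_pythagoras:
  fixes X :: "real mat"
  assumes X: "X \<in> carrier_mat m N" and d: "d \<in> carrier_vec N" and e: "e \<in> carrier_vec N"
    and normal: "\<And>j. t \<le> j \<Longrightarrow> j < N \<Longrightarrow> ((transpose_mat X * X) *\<^sub>v d) $ j = 0"
    and supp: "\<And>j. j < t \<Longrightarrow> j < N \<Longrightarrow> e $ j = 0"
  shows "(X *\<^sub>v (d + e)) \<bullet> (X *\<^sub>v (d + e)) = (X *\<^sub>v d) \<bullet> (X *\<^sub>v d) + (X *\<^sub>v e) \<bullet> (X *\<^sub>v e)"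
proof -
  have Xd: "X *\<^sub>v d \<in> carrier_vec m" and Xe: "X *\<^sub>v e \<in> carrier_vec m" using X d e by auto
  have "(X *\<^sub>v e) \<bullet> (X *\<^sub>v d) = (\<Sum>j\<in>{0..<N}. e $ j * ((transpose_mat X * X) *\<^sub>v d) $ j)"
    unfolding gram_scalar_prod[OF X e d] using X by (simp add: scalar_prod_def)
  \<comment> \<open>In each product one factor is zero: \<open>e\<close> vanishes before
    \<open>t\<close>, the Gram image of \<open>d\<close> from \<open>t\<close> on.\<close>
  also have "\<dots> = 0"
    by (intro sum.neutral ballI) (metis atLeastLessThan_iff mult_eq_0_iff normal not_le supp)
  finally have ed: "(X *\<^sub>v e) \<bullet> (X *\<^sub>v d) = 0" .
  then have "(X *\<^sub>v d) \<bullet> (X *\<^sub>v e) = 0" using comm_scalar_prod[OF Xd Xe] by simp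
  with ed show ?thesis
    using Xd Xe
    by (simp add: mult_add_distrib_mat_vec[OF X d e] scalar_prod_add_distrib[of _ m]
        add_scalar_prod_distrib[of _ m])
qed

text \<open>A left inverse of the Gram matrix makes \<open>X\<close> injective.\<close>

lemma gram_positive_definite:
  fixes X :: "real mat"
  assumes X: "X \<in> carrier_mat m N" and G: "G \<in> carrier_mat N N"
    and inv: "G * (transpose_mat X * X) = 1\<^sub>m N"
    and e: "e \<in> carrier_vec N" and nz: "e \<noteq> 0\<^sub>v N"
  shows "(X *\<^sub>v e) \<bullet> (X *\<^sub>v e) > 0"
proof -
  have "X *\<^sub>v e \<noteq> 0\<^sub>v m"
  proof
    assume "X *\<^sub>v e = 0\<^sub>v m"
    then have "(transpose_mat X * X) *\<^sub>v e = 0\<^sub>v N"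
      using X e by (subst assoc_mult_mat_vec[of _ N m _ N]) auto
    then have "(G * (transpose_mat X * X)) *\<^sub>v e = 0\<^sub>v N"
      using X G e by (subst assoc_mult_mat_vec[of _ N N _ N]) auto
    then show False using inv e nz by simp
  qed
  moreover have "X *\<^sub>v e \<in> carrier_vec m" using X e by auto
  ultimately obtain i where "i < m" "(X *\<^sub>v e) $ i \<noteq> 0"
    by (metis carrier_vecD eq_vecI index_zero_vec)
  then show ?thesis
    unfolding scalar_prod_def using X
    by (intro sum_pos2[of _ i]) (auto simp flip: power2_eq_square)
qed

section \<open>Solving the two minimization problems\<close>

lemma grid_argmin_quantization:
  assumes X: "X \<in> carrier_mat m N" and w: "w \<in> carrier_vec N" and t: "t < N"
    and G: "G \<in> carrier_mat N N" "G * (transpose_mat X * X) = 1\<^sub>m N"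
    and normal: "\<And>j. t \<le> j \<Longrightarrow> j < N \<Longrightarrow>
      ((transpose_mat X * X) *\<^sub>v weight_error w q t W) $ j = 0"
  shows "grid_argmin sel A (quantization_objective X w q W t) = round_nearest sel A (W $ 0)"
proof -
  let ?x = "X *\<^sub>v unit_vec N t" and ?d = "weight_error w q t W"
  have "unit_vec N t \<noteq> 0\<^sub>v N" using t by (metis index_unit_vec(1) index_zero_vec(1) zero_neq_one)
  then have pos: "?x \<bullet> ?x > 0" by (intro gram_positive_definite[OF X G]) simp_all
  have "quantization_objective X w q W t p =
    1 / 2 * ((X *\<^sub>v ?d) \<bullet> (X *\<^sub>v ?d)) + (?x \<bullet> ?x / 2) * \<bar>W $ 0 - p\<bar>\<^sup>2" for p
  proof -
    have "X *\<^sub>v ((W $ 0 - p) \<cdot>\<^sub>v unit_vec N t) = (W $ 0 - p) \<cdot>\<^sub>v ?x"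
      using X by (simp add: mult_mat_vec[where nr = m and nc = N])
    then have "(X *\<^sub>v ((W $ 0 - p) \<cdot>\<^sub>v unit_vec N t)) \<bullet> (X *\<^sub>v ((W $ 0 - p) \<cdot>\<^sub>v unit_vec N t))
      = (W $ 0 - p)\<^sup>2 * (?x \<bullet> ?x)"
      by (simp add: power2_eq_square)
    moreover have "(X *\<^sub>v (?d + (W $ 0 - p) \<cdot>\<^sub>v unit_vec N t)) \<bullet>
        (X *\<^sub>v (?d + (W $ 0 - p) \<cdot>\<^sub>v unit_vec N t)) = (X *\<^sub>v ?d) \<bullet> (X *\<^sub>v ?d) +
        (X *\<^sub>v ((W $ 0 - p) \<cdot>\<^sub>v unit_vec N t)) \<bullet> (X *\<^sub>v ((W $ 0 - p) \<cdot>\<^sub>v unit_vec N t))"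
      using t by (intro gram_pythagoras[OF X weight_error_carrier[OF w] _ normal]) auto
    ultimately show ?thesis
      unfolding quantization_objective_eq[OF X w t] by (simp add: algebra_simps)
  qed
  \<comment> \<open>The quadratic coefficient is positive, so the objective and the distance to
    \<open>W $ 0\<close> order the grid alike. Their sets of minimizers are then equal, and
    \<open>sel\<close> receives the same set on both sides.\<close>
  then have less_iff: "quantization_objective X w q W t y < quantization_objective X w q W t p \<longleftrightarrow>
      \<bar>W $ 0 - y\<bar> < \<bar>W $ 0 - p\<bar>" for y p
    using pos by (simp add: not_le[symmetric] abs_le_square_iff)
  show ?thesis
    unfolding round_nearest_def grid_argmin_def is_arg_min_def less_iff ..
qed

lemma update_objective_arg_min_iff:
  assumes X: "X \<in> carrier_mat m N" and w: "w \<in> carrier_vec N" and t: "t < N"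
    and G: "G \<in> carrier_mat N N" "G * (transpose_mat X * X) = 1\<^sub>m N"
    and u: "u \<in> carrier_vec (N - Suc t)"
    and normal: "\<And>j. Suc t \<le> j \<Longrightarrow> j < N \<Longrightarrow>
      ((transpose_mat X * X) *\<^sub>v weight_error w q (Suc t) u) $ j = 0"
  shows "is_arg_min (update_objective X w q t) (\<lambda>v. v \<in> carrier_vec (N - Suc t)) v \<longleftrightarrow> v = u"
proof -
  let ?f = "update_objective X w q t"
  have less: "?f u < ?f v" if v: "v \<in> carrier_vec (N - Suc t)" and neq: "v \<noteq> u" for v
  proof -
    \<comment> \<open>Both candidates share the quantized entries, so their errors differ only
      beyond position \<open>t\<close>, where the normal equations hold for
      \<open>u\<close>.\<close>
    let ?e = "vec N (\<lambda>j. if j < Suc t then 0 else u $ (j - Suc t) - v $ (j - Suc t))"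
    have split: "weight_error w q (Suc t) v = weight_error w q (Suc t) u + ?e"
      using w by (auto simp: weight_error_def)
    have "?f v = ?f u + 1 / 2 * ((X *\<^sub>v ?e) \<bullet> (X *\<^sub>v ?e))"
      unfolding update_objective_eq[OF X w t] split
      by (subst gram_pythagoras[OF X weight_error_carrier[OF w] _ normal]) (auto simp: field_simps)
    moreover have "?e \<noteq> 0\<^sub>v N"
    proof -
      obtain i where "i < N - Suc t" "u $ i \<noteq> v $ i" using u v neq by (auto simp: vec_eq_iff)
      then have "?e $ (i + Suc t) \<noteq> 0" "i + Suc t < N" by auto
      then show ?thesis by (metis index_zero_vec(1))
    qed
    then have "(X *\<^sub>v ?e) \<bullet> (X *\<^sub>v ?e) > 0" by (intro gram_positive_definite[OF X G]) simp_all
    ultimately show ?thesis by simp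
  qed
  show ?thesis
    unfolding is_arg_min_def using less u by (metis less_asym less_irrefl)
qed

theorem corollary3p4:
  fixes X H Hinv L :: "real mat" and w :: "real vec" and m N :: nat
    and A :: "real set" and sel :: "real set \<Rightarrow> real"
  assumes X: "X \<in> carrier_mat m N"
    and H: "H = transpose_mat X * X"
    and inv: "invertible_mat H"
    and w: "w \<in> carrier_vec N"
    and A: "finite A" "A \<noteq> {}"
    and sel: "tie_rule A sel"
    and Hinv: "inverts_mat H Hinv" "inverts_mat Hinv H"
    and L: "cholesky_factor Hinv L"
  shows "(\<exists>q W. argmin_iterates sel A X w q W) \<and>
    (\<forall>q W. argmin_iterates sel A X w q W \<longrightarrow>
       (\<forall>t<N. q t = optq_quantized sel A L w t \<and> W t = optq_weights sel A L w t))"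
proof -
  let ?q = "optq_quantized sel A L w" and ?W = "optq_weights sel A L w"
  have N: "dim_col X = N" using X by simp
  have HN: "H \<in> carrier_mat N N" using X H by simp
  have HG: "H * Hinv = 1\<^sub>m N" using Hinv(1) HN by (simp add: inverts_mat_def)
  have "Hinv * H = 1\<^sub>m (dim_row Hinv)" using Hinv(2) by (simp add: inverts_mat_def)
  \<comment> \<open>The size of \<open>Hinv\<close> is read off from its products with
    \<open>H\<close>.\<close>
  moreover from this have "dim_row Hinv = N"
    using HN by (metis carrier_matD(2) index_mult_mat(3) index_one_mat(3))
  moreover have "dim_col Hinv = N" using HG by (metis index_mult_mat(3) index_one_mat(3))
  ultimately have GN: "Hinv \<in> carrier_mat N N" and GH: "Hinv * (transpose_mat X * X) = 1\<^sub>m N"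
    by (auto simp: H)
  have LN: "L \<in> carrier_mat N N" and lower: "upper_triangular (transpose_mat L)"
    and diag: "\<forall>i<N. L $$ (i, i) > 0" and LL: "H * (L * transpose_mat L) = 1\<^sub>m N"
    using L GN HG by (auto simp: cholesky_factor_def)
  \<comment> \<open>Stated for any \<open>q\<close> that agrees with OPTQ before step
    \<open>t\<close>, so that it applies to an arbitrary run of the argmin procedure as
    well.\<close>
  have normal: "((transpose_mat X * X) *\<^sub>v weight_error w q t (?W t)) $ j = 0"
    if "\<And>s. s < t \<Longrightarrow> q s = ?q s" "t \<le> j" "j < N" for q t j
  proof -
    have "weight_error w q t (?W t) = weight_error w ?q t (?W t)"
      using that(1) by (rule weight_error_cong)
    then show ?thesis
      using optq_error_normal_equations[OF HN w LN LL lower diag _ that(2,3)] that(2,3)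
      by (simp add: H)
  qed
  have q_step: "grid_argmin sel A (quantization_objective X w q (?W t) t) = ?q t"
    if "\<And>s. s < t \<Longrightarrow> q s = ?q s" "t < N" for q t
    unfolding optq_quantized_def[of _ _ _ _ t]
    by (rule grid_argmin_quantization[OF X w that(2) GN GH normal[OF that(1)]])
  have W_step: "is_arg_min (update_objective X w q t) (\<lambda>v. v \<in> carrier_vec (N - Suc t)) v
      \<longleftrightarrow> v = ?W (Suc t)"
    if "\<And>s. s < Suc t \<Longrightarrow> q s = ?q s" "t < N" for q t v
    by (rule update_objective_arg_min_iff[OF X w that(2) GN GH optq_weights_carrier[OF w]
          normal[OF that(1)]])
  \<comment> \<open>Existence: OPTQ itself is such a run.\<close>
  have "argmin_iterates sel A X w ?q ?W"
    unfolding argmin_iterates_def N using q_step W_step by simp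
  \<comment> \<open>Uniqueness: the invariant pairs \<open>W t\<close> with the values quantized
    before it. In the step, \<open>q t\<close> comes first, since the update objective depends on
    it.\<close>
  moreover have "(\<forall>s<t. q s = ?q s) \<and> W t = ?W t"
    if run: "argmin_iterates sel A X w q W" and "t \<le> N" for q W t
    using \<open>t \<le> N\<close>
  proof (induction t)
    case 0
    then show ?case using run by (simp add: argmin_iterates_def)
  next
    case (Suc t)
    then have t: "t < N" and IH: "\<And>s. s < t \<Longrightarrow> q s = ?q s" "W t = ?W t" by auto
    have "q t = ?q t" using run q_step[OF IH(1) t] t IH(2) by (simp add: argmin_iterates_def N)
    then have "q s = ?q s" if "s < Suc t" for s using IH(1) that by (auto simp: less_Suc_eq)
    moreover from this have "W (Suc t) = ?W (Suc t)"
      using W_step[of t q "W (Suc t)"] run t by (auto simp: argmin_iterates_def N)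
    ultimately show ?case by blast
  qed
  \<comment> \<open>The invariant at \<open>Suc t\<close> gives \<open>q t\<close>, the one at
    \<open>t\<close> gives \<open>W t\<close>.\<close>
  ultimately show ?thesis by (meson Suc_leI lessI less_imp_le)
qed

end
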